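(* Let $S$ be a topological semigroup acting on a Hausdorff locally compact space $X$ endowed with an admissible family of open coverings $\mathcal{O}$. Let $\mathcal{F}$ be a filter basis consisting of connected subsets of $S$ and satisfying the following three hypotheses for all $s\in S$ and $A\in\mathcal{F}$: ($\mathrm{H}_{1}$) there exists $B\in\mathcal{F}$ such that $sB\subset A$; ($\mathrm{H}_{2}$) there exists $B\in\mathcal{F}$ such that $Bs\subset A$; ($\mathrm{H}_{3}$) there exists $B\in\mathcal{F}$ such that $B\subset As$. Assume that $K_{A}(x)$, $D_{A}(x)$ (for $A\in\mathcal{F}$), $L_{\mathcal{F}}(x)$ and $J_{\mathcal{F}}(x)$ are nonempty and compact for every $x\in X$. Then $L_{\mathcal{F}}$ is Hausdorff continuous if and only if $L_{\mathcal{F}}(x)$ is $\mathcal{F}$-eventually stable for every $x\in X$.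
   Context: For coverings $\mathcal{U},\mathcal{V}$ of $X$, $\mathcal{V}\leqslant\frac12\mathcal{U}$ means: for all $V,V'\in\mathcal{V}$ with $V\cap V'\neq\emptyset$ there is $U\in\mathcal{U}$ with $V\cup V'\subset U$. Star: $\mathrm{St}[x,\mathcal{U}]=\bigcup\{U\in\mathcal{U}: x\in U\}$. A family $\mathcal{O}$ of open coverings of $X$ is admissible if (1) for any $\mathcal{U},\mathcal{V}\in\mathcal{O}$ there is $\mathcal{W}\in\mathcal{O}$ with $\mathcal{W}\leqslant\frac12\mathcal{U}$ and $\mathcal{W}\leqslant\frac12\mathcal{V}$; and (2) the stars $\mathrm{St}[x,\mathcal{U}]$, $x\in X$, $\mathcal{U}\in\mathcal{O}$, form a basis for the topology of $X$. An action of $S$ on $X$ is a continuous map $S\times X\to X$, $(s,x)\mapsto sx$, with $s(tx)=(st)x$. For $A\subset S$, $Y\subset X$: $AY=\{sy:s\in A,y\in Y\}$, $Ax=A\{x\}$. A filter basis on subsets of $S$ is a (nonempty) family $\mathcal{F}$ of subsets with $\emptyset\notin\mathcal{F}$ such that for $A,B\in\mathcal{F}$ there is $C\in\mathcal{F}$ with $C\subset A\cap B$. Define $K_{A}(x)=\mathrm{cls}(Ax)$, $L_{\mathcal{F}}(x)=\bigcap_{A\in\mathcal{F}}K_{A}(x)$, $D_{A}(x)=\bigcap_{\mathcal{U}\in\mathcal{O}}\mathrm{cls}(A\,\mathrm{St}[x,\mathcal{U}])$, $J_{\mathcal{F}}(x)=\bigcap_{A\in\mathcal{F}}D_{A}(x)$.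 A set $Y\subset X$ is $\mathcal{F}$-eventually stable if for every neighborhood $U$ of $Y$ there is a neighborhood $V$ of $Y$ such that for each $x\in V$ one has $Ax\subset U$ for some $A\in\mathcal{F}$. Let $F:X\to\mathcal{H}(X)$, where $\mathcal{H}(X)$ is the set of nonempty closed subsets of $X$. $F$ is lower semicontinuous at $x$ if for every open $V\subset X$ with $F(x)\cap V\neq\emptyset$ there is a neighborhood $U$ of $x$ with $F(y)\cap V\neq\emptyset$ for all $y\in U$; upper semicontinuous at $x$ if for every open $V$ with $F(x)\subset V$ there is a neighborhood $U$ of $x$ with $F(y)\subset V$ for all $y\in U$; Hausdorff continuous at $x$ if both. $F$ is Hausdorff continuous if it is so at every point of $X$. *)

theory Defs
  imports "HOL-Analysis.Analysis"
begin

(* The semigroup and the phase space are whole types, carrying their topologies through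
   type classes. Neighborhoods are not required to be open. *)

definition nbhd_of_set :: "'x::topological_space set \<Rightarrow> 'x set \<Rightarrow> bool" where
  "nbhd_of_set Y U \<longleftrightarrow> (\<exists>W. open W \<and> Y \<subseteq> W \<and> W \<subseteq> U)"

abbreviation nbhd_of :: "'x::topological_space \<Rightarrow> 'x set \<Rightarrow> bool" where
  "nbhd_of x U \<equiv> nbhd_of_set {x} U"


definition open_covering :: "'x::topological_space set set \<Rightarrow> bool" where
  "open_covering \<U> \<longleftrightarrow> (\<forall>U\<in>\<U>. open U) \<and> \<Union>\<U> = UNIV"

definition half_refines :: "'x set set \<Rightarrow> 'x set set \<Rightarrow> bool" where
  "half_refines \<V> \<U> \<longleftrightarrow>
    (\<forall>V\<in>\<V>. \<forall>V'\<in>\<V>. V \<inter> V' \<noteq> {} \<longrightarrow> (\<exists>U\<in>\<U>. V \<union> V' \<subseteq> U))"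

definition star :: "'x \<Rightarrow> 'x set set \<Rightarrow> 'x set" where
  "star x \<U> = \<Union>{U\<in>\<U>. x \<in> U}"

definition admissible :: "'x::topological_space set set set \<Rightarrow> bool" where
  "admissible \<O> \<longleftrightarrow>
    (\<forall>\<U>\<in>\<O>. open_covering \<U>) \<and>
    (\<forall>\<U>\<in>\<O>. \<forall>\<V>\<in>\<O>. \<exists>\<W>\<in>\<O>. half_refines \<W> \<U> \<and> half_refines \<W> \<V>) \<and>
    topological_basis {star x \<U> | x \<U>. \<U> \<in> \<O>}"


definition semigroup_action ::
    "('s::topological_semigroup_mult \<Rightarrow> 'x::topological_space \<Rightarrow> 'x) \<Rightarrow> bool" where
  "semigroup_action act \<longleftrightarrow>
    continuous_on UNIV (\<lambda>(s, x). act s x) \<and>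
    (\<forall>s t x. act s (act t x) = act (s * t) x)"

definition act_set :: "('s \<Rightarrow> 'x \<Rightarrow> 'x) \<Rightarrow> 's set \<Rightarrow> 'x set \<Rightarrow> 'x set" where
  "act_set act A Y = {act s y | s y. s \<in> A \<and> y \<in> Y}"

definition filter_basis :: "'s set set \<Rightarrow> bool" where
  "filter_basis \<F> \<longleftrightarrow>
    \<F> \<noteq> {} \<and> {} \<notin> \<F> \<and> (\<forall>A\<in>\<F>. \<forall>B\<in>\<F>. \<exists>C\<in>\<F>. C \<subseteq> A \<inter> B)"


definition K_set :: "('s \<Rightarrow> 'x::topological_space \<Rightarrow> 'x) \<Rightarrow> 's set \<Rightarrow> 'x \<Rightarrow> 'x set" where
  "K_set act A x = closure (act_set act A {x})"

definition L_set :: "('s \<Rightarrow> 'x::topological_space \<Rightarrow> 'x) \<Rightarrow> 's set set \<Rightarrow> 'x \<Rightarrow> 'x set" where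
  "L_set act \<F> x = (\<Inter>A\<in>\<F>. K_set act A x)"

definition D_set ::
    "('s \<Rightarrow> 'x::topological_space \<Rightarrow> 'x) \<Rightarrow> 'x set set set \<Rightarrow> 's set \<Rightarrow> 'x \<Rightarrow> 'x set" where
  "D_set act \<O> A x = (\<Inter>\<U>\<in>\<O>. closure (act_set act A (star x \<U>)))"

definition J_set ::
    "('s \<Rightarrow> 'x::topological_space \<Rightarrow> 'x) \<Rightarrow> 'x set set set \<Rightarrow> 's set set \<Rightarrow> 'x \<Rightarrow> 'x set" where
  "J_set act \<O> \<F> x = (\<Inter>A\<in>\<F>. D_set act \<O> A x)"

definition eventually_stable ::
    "('s \<Rightarrow> 'x::topological_space \<Rightarrow> 'x) \<Rightarrow> 's set set \<Rightarrow> 'x set \<Rightarrow> bool" where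
  "eventually_stable act \<F> Y \<longleftrightarrow>
    (\<forall>U. nbhd_of_set Y U \<longrightarrow>
      (\<exists>V. nbhd_of_set Y V \<and> (\<forall>x\<in>V. \<exists>A\<in>\<F>. act_set act A {x} \<subseteq> U)))"


(* Semicontinuity is meant for maps with nonempty closed values; the definitions make sense
   for arbitrary set-valued maps, so this is not built in. *)

definition lower_semicontinuous_at ::
    "('x::topological_space \<Rightarrow> 'x set) \<Rightarrow> 'x \<Rightarrow> bool" where
  "lower_semicontinuous_at F x \<longleftrightarrow>
    (\<forall>V. open V \<and> F x \<inter> V \<noteq> {} \<longrightarrow> (\<exists>U. nbhd_of x U \<and> (\<forall>y\<in>U. F y \<inter> V \<noteq> {})))"

definition upper_semicontinuous_at ::
    "('x::topological_space \<Rightarrow> 'x set) \<Rightarrow> 'x \<Rightarrow> bool" where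
  "upper_semicontinuous_at F x \<longleftrightarrow>
    (\<forall>V. open V \<and> F x \<subseteq> V \<longrightarrow> (\<exists>U. nbhd_of x U \<and> (\<forall>y\<in>U. F y \<subseteq> V)))"

definition Hausdorff_continuous_at ::
    "('x::topological_space \<Rightarrow> 'x set) \<Rightarrow> 'x \<Rightarrow> bool" where
  "Hausdorff_continuous_at F x \<longleftrightarrow> lower_semicontinuous_at F x \<and> upper_semicontinuous_at F x"

definition Hausdorff_continuous :: "('x::topological_space \<Rightarrow> 'x set) \<Rightarrow> bool" where
  "Hausdorff_continuous F \<longleftrightarrow> (\<forall>x. Hausdorff_continuous_at F x)"

end

theory Submission
  imports Defs
begin

text \<open>
  Two facts about the limit sets \<open>L x\<close> carry everything. They are constant along orbits,
  \<open>L (s x) = L x\<close>, by \<open>H2\<close> and \<open>H3\<close>, and they are forward invariant, by \<open>H1\<close>; in particular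
  \<open>L y \<subseteq> L x\<close> whenever \<open>y \<in> L x\<close>. Moreover, by compactness, a neighborhood of \<open>L x\<close>
  contains \<open>A x\<close> for some \<open>A\<close> in the filter basis.

  If \<open>L\<close> is upper semicontinuous, a neighborhood \<open>U\<close> of \<open>L x\<close> is also one of \<open>L y\<close> for each
  \<open>y \<in> L x\<close>, so \<open>L z \<subseteq> U\<close> for all \<open>z\<close> near \<open>y\<close>, and then \<open>A z \<subseteq> U\<close> for some \<open>A\<close>. Hence
  \<open>L x\<close> is eventually stable.

  Conversely, let all limit sets be eventually stable. As the space is regular, every neighborhood
  \<open>V\<close> of \<open>L x\<close> contains \<open>L z\<close> for all \<open>z\<close> in some neighborhood \<open>W\<close> of \<open>L x\<close>
  (\<open>stable_imp_L_near\<close>). Some \<open>s\<close> carries \<open>x\<close>, hence all \<open>y\<close> near \<open>x\<close>, into \<open>W\<close>, and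
  \<open>L y = L (s y) \<subseteq> V\<close>: this is upper semicontinuity. Stability also makes limit sets minimal
  (\<open>stable_imp_L_minimal\<close>): the orbit of \<open>x\<close> comes close to \<open>L y\<close> if \<open>y \<in> L x\<close>, and is then
  trapped near it, so \<open>L y = L x\<close>. For lower semicontinuity at \<open>x\<close>, let the open set \<open>V\<close> meet
  \<open>L x\<close>. By minimality each point of \<open>L x\<close> is carried into \<open>V\<close> by some \<open>s\<close>, and so are all
  points of some neighborhood of \<open>L x\<close>. By upper semicontinuity \<open>L y\<close> lies in that neighborhood
  for \<open>y\<close> near \<open>x\<close>, so some \<open>s\<close> carries a point of \<open>L y\<close> into \<open>V\<close>, and its image stays in
  \<open>L y\<close> by forward invariance.
\<close>

section \<open>Orbit closures along a filter basis\<close>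

lemma action_assoc:
  "semigroup_action act \<Longrightarrow> act s (act t x) = act (s * t) x"
  by (simp add: semigroup_action_def)

lemma action_continuous:
  assumes "semigroup_action act"
  shows "continuous_on UNIV (act s)"
proof -
  have "continuous_on UNIV ((\<lambda>(s, x). act s x) \<circ> (\<lambda>x. (s, x)))"
    using assms
    by (intro continuous_on_compose continuous_intros)
      (auto simp: semigroup_action_def intro: continuous_on_subset)
  then show ?thesis by (simp add: o_def)
qed

lemma open_action_vimage:
  assumes "semigroup_action act" "open W"
  shows "open (act s -` W)"
  using open_vimage[OF assms(2) action_continuous[OF assms(1)]] .

lemma nbhd_of_set_open: "open U \<Longrightarrow> Y \<subseteq> U \<Longrightarrow> nbhd_of_set Y U"
  by (auto simp: nbhd_of_set_def)

lemma act_set_singleton: "act_set act A {x} = (\<lambda>s. act s x) ` A"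
  by (auto simp: act_set_def)

lemma act_set_subset_K: "act_set act A {x} \<subseteq> K_set act A x"
  by (simp add: K_set_def closure_subset)

lemma closed_L: "closed (L_set act \<F> x)"
  by (auto simp: L_set_def K_set_def)

lemma K_mono: "A \<subseteq> B \<Longrightarrow> K_set act A x \<subseteq> K_set act B x"
  by (auto simp: K_set_def act_set_def intro!: closure_mono)

lemma filter_basis_finite_lower_bound:
  assumes "filter_basis \<F>" "finite \<C>" "\<C> \<subseteq> \<F>"
  obtains B where "B \<in> \<F>" "\<And>C. C \<in> \<C> \<Longrightarrow> B \<subseteq> C"
proof -
  have "\<exists>B\<in>\<F>. \<forall>C\<in>\<C>. B \<subseteq> C"
    using assms(2,3)
  proof (induction \<C>)
    case empty
    then show ?case using assms(1) by (auto simp: filter_basis_def)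
  next
    case (insert C \<C>)
    then obtain B where B: "B \<in> \<F>" "\<forall>C\<in>\<C>. B \<subseteq> C" by auto
    obtain E where "E \<in> \<F>" "E \<subseteq> B \<inter> C"
      using assms(1) B(1) insert.prems unfolding filter_basis_def by (metis insert_subset)
    with B(2) show ?case by blast
  qed
  then show thesis using that by blast
qed

text \<open>The sets \<open>K A x\<close> form a downward directed family of compact sets with intersection \<open>L x\<close>.\<close>

lemma K_eventually_near_L:
  fixes act :: "'s \<Rightarrow> 'x::t2_space \<Rightarrow> 'x"
  assumes "filter_basis \<F>" "\<forall>A\<in>\<F>. compact (K_set act A x)"
    and "open W" "L_set act \<F> x \<subseteq> W"
  obtains A where "A \<in> \<F>" "K_set act A x \<subseteq> W"
proof -
  obtain A\<^sub>0 where A0: "A\<^sub>0 \<in> \<F>" using assms(1) by (auto simp: filter_basis_def)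
  have "compact (K_set act A\<^sub>0 x - W)"
    using assms(2,3) A0 by (simp add: compact_diff)
  moreover have "K_set act A\<^sub>0 x - W \<subseteq> (\<Union>A\<in>\<F>. - K_set act A x)"
    using assms(4) by (auto simp: L_set_def)
  moreover have "open (- K_set act A x)" if "A \<in> \<F>" for A
    by (simp add: K_set_def open_Compl)
  ultimately obtain \<C> where C: "\<C> \<subseteq> \<F>" "finite \<C>"
    "K_set act A\<^sub>0 x - W \<subseteq> (\<Union>A\<in>\<C>. - K_set act A x)"
    using compactE_image[of "K_set act A\<^sub>0 x - W" \<F> "\<lambda>A. - K_set act A x"] by metis
  obtain B where B: "B \<in> \<F>" "\<And>C. C \<in> insert A\<^sub>0 \<C> \<Longrightarrow> B \<subseteq> C"
    using filter_basis_finite_lower_bound[OF assms(1), of "insert A\<^sub>0 \<C>"] C A0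
    by (metis finite_insert insert_subset)
  have "K_set act B x \<subseteq> K_set act A x" if "A \<in> insert A\<^sub>0 \<C>" for A
    using B(2)[OF that] by (rule K_mono)
  then have "K_set act B x \<subseteq> W" using C(3) by blast
  with B(1) that show thesis by blast
qed

section \<open>Invariance of limit sets\<close>

text \<open>
  \<open>K A (s x) = K (A s) x\<close>, and \<open>H2\<close> and \<open>H3\<close> say that the sets \<open>A s\<close> generate the same
  filter as the sets \<open>A\<close>.
\<close>

lemma L_orbit:
  assumes act: "semigroup_action act"
    and H2: "\<forall>s. \<forall>A\<in>\<F>. \<exists>B\<in>\<F>. (\<lambda>b. b * s) ` B \<subseteq> A"
    and H3: "\<forall>s. \<forall>A\<in>\<F>. \<exists>B\<in>\<F>. B \<subseteq> (\<lambda>a. a * s) ` A"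
  shows "L_set act \<F> (act s x) = L_set act \<F> x"
proof -
  have K: "K_set act A (act s x) = K_set act ((\<lambda>a. a * s) ` A) x" for A
    by (simp add: K_set_def act_set_singleton image_image action_assoc[OF act])
  have "L_set act \<F> (act s x) \<subseteq> K_set act A x" if A: "A \<in> \<F>" for A
  proof -
    obtain B where "B \<in> \<F>" "(\<lambda>b. b * s) ` B \<subseteq> A" using H2 A by blast
    then have "K_set act B (act s x) \<subseteq> K_set act A x" unfolding K by (intro K_mono)
    with \<open>B \<in> \<F>\<close> show ?thesis unfolding L_set_def by (rule INF_lower2)
  qed
  moreover have "L_set act \<F> x \<subseteq> K_set act A (act s x)" if A: "A \<in> \<F>" for A
  proof -
    obtain B where "B \<in> \<F>" "B \<subseteq> (\<lambda>a. a * s) ` A" using H3 A by blast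
    then have "K_set act B x \<subseteq> K_set act A (act s x)" unfolding K by (intro K_mono)
    with \<open>B \<in> \<F>\<close> show ?thesis unfolding L_set_def by (rule INF_lower2)
  qed
  ultimately show ?thesis
    unfolding L_set_def by (intro equalityI INF_greatest)
qed

lemma L_forward_invariant:
  assumes act: "semigroup_action act"
    and H1: "\<forall>s. \<forall>A\<in>\<F>. \<exists>B\<in>\<F>. (\<lambda>b. s * b) ` B \<subseteq> A"
    and y: "y \<in> L_set act \<F> x"
  shows "act s y \<in> L_set act \<F> x"
  unfolding L_set_def
proof
  fix A assume "A \<in> \<F>"
  then obtain B where B: "B \<in> \<F>" "(\<lambda>b. s * b) ` B \<subseteq> A" using H1 by blast
  have "act s y \<in> act s ` closure (act_set act B {x})"
    using y B(1) by (auto simp: L_set_def K_set_def)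
  also have "\<dots> \<subseteq> closure (act s ` act_set act B {x})"
    by (rule image_closure_subset)
      (auto intro: continuous_on_subset[OF action_continuous[OF act]] closure_subset[THEN subsetD])
  also have "act s ` act_set act B {x} = act_set act ((\<lambda>b. s * b) ` B) {x}"
    by (simp add: act_set_singleton image_image action_assoc[OF act])
  also have "closure \<dots> \<subseteq> K_set act A x"
    using K_mono[OF B(2)] by (simp add: K_set_def)
  finally show "act s y \<in> K_set act A x" .
qed

lemma L_subset_L:
  assumes "semigroup_action act" "\<F> \<noteq> {}"
    and "\<forall>s. \<forall>A\<in>\<F>. \<exists>B\<in>\<F>. (\<lambda>b. s * b) ` B \<subseteq> A"
    and "y \<in> L_set act \<F> x"
  shows "L_set act \<F> y \<subseteq> L_set act \<F> x"
proof -
  obtain A where A: "A \<in> \<F>" using assms(2) by blast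
  have "K_set act A y \<subseteq> L_set act \<F> x"
    unfolding K_set_def using L_forward_invariant[OF assms(1,3,4)]
    by (intro closure_minimal closed_L) (auto simp: act_set_singleton)
  with A show ?thesis by (auto simp: L_set_def)
qed

section \<open>Eventual stability implies continuity\<close>

lemma locally_compact_closure_between:
  fixes K :: "'x::t2_space set"
  assumes "locally_compact_space (euclidean :: 'x topology)"
    and "compact K" "open V" "K \<subseteq> V"
  obtains W where "open W" "K \<subseteq> W" "closure W \<subseteq> V"
proof -
  have "Hausdorff_space (euclidean :: 'x topology)"
    unfolding Hausdorff_space_def disjnt_def by (simp, metis hausdorff)
  then have "regular_space (euclidean :: 'x topology)"
    using assms(1) by (intro locally_compact_Hausdorff_imp_regular_space)
  moreover have "compactin euclidean K" "closedin euclidean (- V)" "disjnt K (- V)"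
    using assms(2-4) by (auto simp: disjnt_def)
  ultimately have
    "\<exists>W E. openin euclidean W \<and> openin euclidean E \<and> K \<subseteq> W \<and> - V \<subseteq> E \<and> disjnt W E"
    by (rule regular_space_compact_closed_separation)
  then obtain W E where WE: "open W" "open E" "K \<subseteq> W" "- V \<subseteq> E" "disjnt W E"
    by (elim exE conjE) (simp only: open_openin)
  have "closure W \<subseteq> - E"
    using WE by (intro closure_minimal) (auto simp: disjnt_def)
  with WE that show thesis by blast
qed

text \<open>
  Eventual stability only says that each orbit starting near \<open>L x\<close> is eventually contained in a
  given neighborhood. Its limit set lies in the closure, so one passes first to a smaller
  neighborhood whose closure is still inside the given one.
\<close>

lemma stable_imp_L_near:
  fixes act :: "'s \<Rightarrow> 'x::t2_space \<Rightarrow> 'x"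
  assumes "locally_compact_space (euclidean :: 'x topology)"
    and "compact (L_set act \<F> x)" "eventually_stable act \<F> (L_set act \<F> x)"
    and "open V" "L_set act \<F> x \<subseteq> V"
  obtains W where "open W" "L_set act \<F> x \<subseteq> W" "\<forall>z\<in>W. L_set act \<F> z \<subseteq> V"
proof -
  obtain U where U: "open U" "L_set act \<F> x \<subseteq> U" "closure U \<subseteq> V"
    using locally_compact_closure_between[OF assms(1,2,4,5)] .
  then obtain N where N: "nbhd_of_set (L_set act \<F> x) N"
    "\<forall>z\<in>N. \<exists>A\<in>\<F>. act_set act A {z} \<subseteq> U"
    using assms(3) nbhd_of_set_open unfolding eventually_stable_def by meson
  then obtain W where W: "open W" "L_set act \<F> x \<subseteq> W" "W \<subseteq> N"
    by (auto simp: nbhd_of_set_def)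
  have "L_set act \<F> z \<subseteq> V" if "z \<in> W" for z
  proof -
    have "z \<in> N" using W(3) that by blast
    then obtain A where A: "A \<in> \<F>" "act_set act A {z} \<subseteq> U" using N(2) by blast
    have "K_set act A z \<subseteq> V"
      using closure_mono[OF A(2)] U(3) unfolding K_set_def by (rule subset_trans)
    with A(1) show ?thesis unfolding L_set_def by (rule INF_lower2)
  qed
  with W that show thesis by blast
qed

lemma orbit_meets_open:
  assumes "\<F> \<noteq> {}" "open V" "L_set act \<F> x \<inter> V \<noteq> {}"
  obtains s where "act s x \<in> V"
proof -
  obtain A where "A \<in> \<F>" using assms(1) by blast
  then have "closure (act_set act A {x}) \<inter> V \<noteq> {}"
    using assms(3) by (auto simp: L_set_def K_set_def)
  then have "act_set act A {x} \<inter> V \<noteq> {}"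
    using open_Int_closure_eq_empty[OF assms(2)] by (metis inf_commute)
  then show thesis using that by (auto simp: act_set_singleton)
qed

text \<open>
  If \<open>q \<in> L x\<close> were outside \<open>L y\<close>, stability would provide a neighborhood of \<open>L y\<close> from which
  no limit set reaches \<open>q\<close>. But the orbit of \<open>x\<close> accumulates on \<open>L y \<subseteq> L x\<close>, hence visits that
  neighborhood, and the visiting point has the same limit set as \<open>x\<close>.
\<close>

lemma stable_imp_L_minimal:
  fixes act :: "'s::topological_semigroup_mult \<Rightarrow> 'x::t2_space \<Rightarrow> 'x"
  assumes lc: "locally_compact_space (euclidean :: 'x topology)"
    and act: "semigroup_action act" and ne: "\<F> \<noteq> {}"
    and H1: "\<forall>s. \<forall>A\<in>\<F>. \<exists>B\<in>\<F>. (\<lambda>b. s * b) ` B \<subseteq> A"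
    and H2: "\<forall>s. \<forall>A\<in>\<F>. \<exists>B\<in>\<F>. (\<lambda>b. b * s) ` B \<subseteq> A"
    and H3: "\<forall>s. \<forall>A\<in>\<F>. \<exists>B\<in>\<F>. B \<subseteq> (\<lambda>a. a * s) ` A"
    and Ly: "L_set act \<F> y \<noteq> {}" "compact (L_set act \<F> y)"
      "eventually_stable act \<F> (L_set act \<F> y)"
    and y: "y \<in> L_set act \<F> x"
  shows "L_set act \<F> y = L_set act \<F> x"
proof (intro equalityI subsetI)
  have sub: "L_set act \<F> y \<subseteq> L_set act \<F> x" using L_subset_L[OF act ne H1 y] .
  then show "q \<in> L_set act \<F> x" if "q \<in> L_set act \<F> y" for q using that by blast
  show "q \<in> L_set act \<F> y" if q: "q \<in> L_set act \<F> x" for q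
  proof (rule ccontr)
    assume "q \<notin> L_set act \<F> y"
    then have "open (- {q})" "L_set act \<F> y \<subseteq> - {q}" by auto
    then obtain W where W: "open W" "L_set act \<F> y \<subseteq> W" "\<forall>z\<in>W. L_set act \<F> z \<subseteq> - {q}"
      using stable_imp_L_near[OF lc Ly(2,3)] by metis
    have "L_set act \<F> x \<inter> W \<noteq> {}" using sub W(2) Ly(1) by blast
    then obtain s where "act s x \<in> W" using orbit_meets_open[OF ne W(1)] by metis
    then have "L_set act \<F> x \<subseteq> - {q}" using W(3) L_orbit[OF act H2 H3] by metis
    with q show False by blast
  qed
qed

lemma stable_imp_upper_semicontinuous:
  fixes act :: "'s::topological_semigroup_mult \<Rightarrow> 'x::t2_space \<Rightarrow> 'x"
  assumes lc: "locally_compact_space (euclidean :: 'x topology)"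
    and act: "semigroup_action act" and ne: "\<F> \<noteq> {}"
    and H2: "\<forall>s. \<forall>A\<in>\<F>. \<exists>B\<in>\<F>. (\<lambda>b. b * s) ` B \<subseteq> A"
    and H3: "\<forall>s. \<forall>A\<in>\<F>. \<exists>B\<in>\<F>. B \<subseteq> (\<lambda>a. a * s) ` A"
    and Lx: "L_set act \<F> x \<noteq> {}" "compact (L_set act \<F> x)"
      "eventually_stable act \<F> (L_set act \<F> x)"
  shows "upper_semicontinuous_at (L_set act \<F>) x"
  unfolding upper_semicontinuous_at_def
proof (intro allI impI, elim conjE)
  fix V assume V: "open V" "L_set act \<F> x \<subseteq> V"
  obtain W where W: "open W" "L_set act \<F> x \<subseteq> W" "\<forall>z\<in>W. L_set act \<F> z \<subseteq> V"
    by (rule stable_imp_L_near[OF lc Lx(2,3) V])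
  have "L_set act \<F> x \<inter> W \<noteq> {}" using W(2) Lx(1) by blast
  then obtain s where s: "act s x \<in> W" by (rule orbit_meets_open[OF ne W(1)])
  then have "nbhd_of x (act s -` W)"
    using open_action_vimage[OF act W(1)] by (intro nbhd_of_set_open) auto
  moreover have "L_set act \<F> y \<subseteq> V" if "y \<in> act s -` W" for y
    using W(3)[rule_format, of "act s y"] that by (simp add: L_orbit[OF act H2 H3])
  ultimately show "\<exists>U. nbhd_of x U \<and> (\<forall>y\<in>U. L_set act \<F> y \<subseteq> V)"
    by (intro exI[of _ "act s -` W"]) simp
qed

text \<open>
  Forward invariance turns upper into lower semicontinuity once limit sets are minimal: the open
  set of points that some \<open>s\<close> carries into \<open>V\<close> contains all of \<open>L x\<close> as soon as \<open>V\<close> meets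
  \<open>L x\<close>, and a limit set meeting this open set meets \<open>V\<close>.
\<close>

lemma minimal_imp_lower_semicontinuous:
  assumes act: "semigroup_action act" and ne: "\<F> \<noteq> {}"
    and H1: "\<forall>s. \<forall>A\<in>\<F>. \<exists>B\<in>\<F>. (\<lambda>b. s * b) ` B \<subseteq> A"
    and L: "\<forall>y. L_set act \<F> y \<noteq> {}"
    and minimal: "\<And>z. z \<in> L_set act \<F> x \<Longrightarrow> L_set act \<F> z = L_set act \<F> x"
    and usc: "upper_semicontinuous_at (L_set act \<F>) x"
  shows "lower_semicontinuous_at (L_set act \<F>) x"
  unfolding lower_semicontinuous_at_def
proof (intro allI impI, elim conjE)
  fix V assume V: "open V" "L_set act \<F> x \<inter> V \<noteq> {}"
  define W where "W = (\<Union>s. act s -` V)"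
  have "open W" unfolding W_def using open_action_vimage[OF act V(1)] by blast
  moreover have "L_set act \<F> x \<subseteq> W"
  proof
    fix z assume "z \<in> L_set act \<F> x"
    then have "L_set act \<F> z \<inter> V \<noteq> {}" using minimal V(2) by simp
    then obtain s where "act s z \<in> V" by (rule orbit_meets_open[OF ne V(1)])
    then show "z \<in> W" by (auto simp: W_def)
  qed
  ultimately obtain U where U: "nbhd_of x U" "\<forall>y\<in>U. L_set act \<F> y \<subseteq> W"
    using usc unfolding upper_semicontinuous_at_def by blast
  have "L_set act \<F> y \<inter> V \<noteq> {}" if y: "y \<in> U" for y
  proof -
    obtain w where w: "w \<in> L_set act \<F> y" using L by blast
    then have "w \<in> W" using U(2) y by blast
    then obtain s where "act s w \<in> V" by (auto simp: W_def)
    with L_forward_invariant[OF act H1 w] show ?thesis by blast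
  qed
  with U(1) show "\<exists>U. nbhd_of x U \<and> (\<forall>y\<in>U. L_set act \<F> y \<inter> V \<noteq> {})" by blast
qed

section \<open>Upper semicontinuity implies eventual stability\<close>

text \<open>
  The neighborhood of \<open>L x\<close> is glued from neighborhoods of its points \<open>y\<close>, obtained from upper
  semicontinuity at \<open>y\<close>; the point \<open>x\<close> itself need not lie in \<open>L x\<close>, so semicontinuity at \<open>x\<close>
  would control nothing near \<open>L x\<close>.
\<close>

lemma upper_semicontinuous_imp_stable:
  fixes act :: "'s::topological_semigroup_mult \<Rightarrow> 'x::t2_space \<Rightarrow> 'x"
  assumes act: "semigroup_action act" and fb: "filter_basis \<F>"
    and H1: "\<forall>s. \<forall>A\<in>\<F>. \<exists>B\<in>\<F>. (\<lambda>b. s * b) ` B \<subseteq> A"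
    and K: "\<forall>z. \<forall>A\<in>\<F>. compact (K_set act A z)"
    and usc: "\<And>y. y \<in> L_set act \<F> x \<Longrightarrow> upper_semicontinuous_at (L_set act \<F>) y"
  shows "eventually_stable act \<F> (L_set act \<F> x)"
  unfolding eventually_stable_def
proof (intro allI impI)
  fix N assume "nbhd_of_set (L_set act \<F> x) N"
  then obtain U where U: "open U" "L_set act \<F> x \<subseteq> U" "U \<subseteq> N"
    by (auto simp: nbhd_of_set_def)
  have ne: "\<F> \<noteq> {}" using fb by (simp add: filter_basis_def)
  define W where "W = \<Union>{G. open G \<and> (\<forall>z\<in>G. L_set act \<F> z \<subseteq> U)}"
  have "open W" unfolding W_def by blast
  moreover have "L_set act \<F> x \<subseteq> W"
  proof
    fix y assume y: "y \<in> L_set act \<F> x"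
    have "L_set act \<F> y \<subseteq> U" using L_subset_L[OF act ne H1 y] U(2) by blast
    then obtain G where "nbhd_of y G" "\<forall>z\<in>G. L_set act \<F> z \<subseteq> U"
      using usc[OF y] U(1) unfolding upper_semicontinuous_at_def by blast
    then show "y \<in> W" unfolding W_def nbhd_of_set_def by blast
  qed
  moreover have "\<exists>A\<in>\<F>. act_set act A {z} \<subseteq> N" if "z \<in> W" for z
  proof -
    have "L_set act \<F> z \<subseteq> U" using that unfolding W_def by blast
    then obtain A where "A \<in> \<F>" "K_set act A z \<subseteq> U"
      using K_eventually_near_L[OF fb _ U(1)] K by metis
    then show ?thesis using act_set_subset_K U(3) by blast
  qed
  ultimately show "\<exists>V. nbhd_of_set (L_set act \<F> x) V \<and> (\<forall>z\<in>V. \<exists>A\<in>\<F>. act_set act A {z} \<subseteq> N)"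
    using nbhd_of_set_open by blast
qed

theorem theorem11:
  fixes act :: "'s::topological_semigroup_mult \<Rightarrow> 'x::t2_space \<Rightarrow> 'x"
    and \<O> :: "'x set set set"
    and \<F> :: "'s set set"
  assumes "locally_compact_space (euclidean :: 'x topology)"
    and "semigroup_action act"
    and "admissible \<O>"
    and "filter_basis \<F>"
    and "\<forall>A\<in>\<F>. connected A"
    and H1: "\<forall>s. \<forall>A\<in>\<F>. \<exists>B\<in>\<F>. (\<lambda>b. s * b) ` B \<subseteq> A"
    and H2: "\<forall>s. \<forall>A\<in>\<F>. \<exists>B\<in>\<F>. (\<lambda>b. b * s) ` B \<subseteq> A"
    and H3: "\<forall>s. \<forall>A\<in>\<F>. \<exists>B\<in>\<F>. B \<subseteq> (\<lambda>a. a * s) ` A"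
    and "\<forall>x. \<forall>A\<in>\<F>. K_set act A x \<noteq> {} \<and> compact (K_set act A x)"
    and "\<forall>x. \<forall>A\<in>\<F>. D_set act \<O> A x \<noteq> {} \<and> compact (D_set act \<O> A x)"
    and "\<forall>x. L_set act \<F> x \<noteq> {} \<and> compact (L_set act \<F> x)"
    and "\<forall>x. J_set act \<O> \<F> x \<noteq> {} \<and> compact (J_set act \<O> \<F> x)"
  shows "Hausdorff_continuous (L_set act \<F>) \<longleftrightarrow>
    (\<forall>x. eventually_stable act \<F> (L_set act \<F> x))"
proof
  have ne: "\<F> \<noteq> {}" using assms(4) by (simp add: filter_basis_def)
  {
    assume "Hausdorff_continuous (L_set act \<F>)"
    then show "\<forall>x. eventually_stable act \<F> (L_set act \<F> x)"
      using upper_semicontinuous_imp_stable[OF assms(2,4) H1] assms(9)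
      by (simp add: Hausdorff_continuous_def Hausdorff_continuous_at_def)
  next
    assume stable: "\<forall>x. eventually_stable act \<F> (L_set act \<F> x)"
    have usc: "upper_semicontinuous_at (L_set act \<F>) x" for x
      using stable_imp_upper_semicontinuous[OF assms(1,2) ne H2 H3] assms(11) stable by blast
    have "L_set act \<F> z = L_set act \<F> x" if "z \<in> L_set act \<F> x" for x z
      using stable_imp_L_minimal[OF assms(1,2) ne H1 H2 H3 _ _ _ that] assms(11) stable by blast
    then have "lower_semicontinuous_at (L_set act \<F>) x" for x
      using minimal_imp_lower_semicontinuous[OF assms(2) ne H1] assms(11) usc by blast
    with usc show "Hausdorff_continuous (L_set act \<F>)"
      by (simp add: Hausdorff_continuous_def Hausdorff_continuous_at_def)
  }
qed

end
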